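(* Let $\mu$ be a nontrivial probability measure on $\partial\mathbb D$ with Verblunsky coefficients $(\alpha_n)$, and suppose $\lim_{n\to\infty}|\alpha_n|^{1/n}=r$ and $\frac1n\sum_{j=0}^{n-1}|\alpha_j|\to0$. Then the zero counting measures $\nu_n$ of $\Phi_n$ converge weakly to the uniform probability measure on the circle $\{|z|=r\}$.
   Context: $\partial\mathbb D$ is the unit circle; nontrivial means infinite support. $\Phi_n$ is the monic polynomial of degree $n$ with $\int\overline{z^j}\Phi_n\,d\mu=0$ for $0\le j<n$; $\alpha_n=-\overline{\Phi_{n+1}(0)}$. $\nu_n$ is the probability measure on $\overline{\mathbb D}$ giving weight $k/n$ to each zero of $\Phi_n$ of multiplicity $k$. *)

theory Defs
  imports "HOL-Probability.Probability" "HOL-Computational_Algebra.Polynomial"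
begin

definition msupport :: "complex measure \<Rightarrow> complex set" where
  "msupport mu = {z. \<forall>e>0. emeasure mu (ball z e) > 0}"

definition OPUC :: "complex measure \<Rightarrow> nat \<Rightarrow> complex poly" where
  "OPUC mu n = (THE p. degree p = n \<and> lead_coeff p = 1 \<and>
      (\<forall>j<n. (\<integral>z. cnj (z ^ j) * poly p z \<partial>mu) = 0))"

definition verblunsky :: "complex measure \<Rightarrow> nat \<Rightarrow> complex" where
  "verblunsky mu n = - cnj (poly (OPUC mu (Suc n)) 0)"

definition zero_mset :: "complex poly \<Rightarrow> complex multiset" where
  "zero_mset p = Abs_multiset (\<lambda>z. if p = 0 then 0 else order z p)"

definition zero_counting_measure :: "complex measure \<Rightarrow> nat \<Rightarrow> complex measure" where
  "zero_counting_measure mu n = measure_pmf (pmf_of_multiset (zero_mset (OPUC mu n)))"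

text \<open>Uniform probability measure on the circle {|z| = r} (Dirac at 0 if r = 0).\<close>
definition circle_uniform :: "real \<Rightarrow> complex measure" where
  "circle_uniform r = distr (uniform_measure lborel {0..2*pi}) borel (\<lambda>t. complex_of_real r * cis t)"

definition weak_conv_c :: "(nat \<Rightarrow> complex measure) \<Rightarrow> complex measure \<Rightarrow> bool" where
  "weak_conv_c Ms M \<longleftrightarrow> (\<forall>f :: complex \<Rightarrow> real. continuous_on UNIV f \<and> bounded (range f) \<longrightarrow>
      (\<lambda>n. \<integral>x. f x \<partial>Ms n) \<longlonglongrightarrow> (\<integral>x. f x \<partial>M))"

end

theory Submission
  imports Defs "HOL-Complex_Analysis.Complex_Analysis"
    "HOL-Computational_Algebra.Fundamental_Theorem_Algebra" "HOL-Real_Asymp.Real_Asymp"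
begin

text \<open>
  All zeros of \<open>\<Phi>\<^sub>n\<close> lie in the unit disk, so it suffices to test weak convergence on the
  monomials \<open>z\<^sup>a cnj z\<^sup>b\<close>, and these are controlled by the moduli and the power sums of the zeros.

  Moduli: the Szego recursion bounds \<open>|\<Phi>\<^sub>n|\<close> on \<open>|z| = \<rho>\<close> by a multiple of \<open>n R\<^sup>n\<close>, for any
  \<open>R > max \<rho> r\<close>, and the maximum principle turns this into an upper bound for the mean of
  \<open>ln (max |z| \<rho>)\<close> over the zeros \<open>z\<close>. Since the mean of \<open>ln |z|\<close> over the zeros of \<open>\<Phi>\<^sub>n\<close> is
  \<open>ln |\<alpha>\<^sub>n\<^sub>-\<^sub>1| / n\<close>, which tends to \<open>ln r\<close>, the moduli converge to \<open>r\<close> in mean; for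
  \<open>r = 0\<close> the upper bound alone suffices.

  Power sums: the reversed polynomial is \<open>\<Phi>\<^sub>n\<^sup>*(w) = \<Prod>\<^sub>z (1 - cnj z w)\<close>, so the power sums of
  the zeros are, up to a factor and conjugation, Taylor coefficients of \<open>log \<Phi>\<^sub>n\<^sup>*\<close>. The
  recursion also writes \<open>\<Phi>\<^sub>n\<^sup>*\<close> as the product of the factors \<open>1 - \<alpha>\<^sub>j w b\<^sub>j(w)\<close>, \<open>j < n\<close>, where
  the Blaschke product \<open>b\<^sub>j = \<Phi>\<^sub>j / \<Phi>\<^sub>j\<^sup>*\<close> satisfies \<open>|b\<^sub>j| \<le> 1\<close> on the disk. This bounds the
  logarithm by \<open>\<Sum>\<^sub>j\<^sub><\<^sub>n |\<alpha>\<^sub>j| = o(n)\<close>, and all power means of the zeros tend to \<open>0\<close>.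
\<close>

section \<open>Products over multisets and roots of polynomials\<close>

lemma norm_prod_mset:
  fixes f :: "'a \<Rightarrow> 'b :: {real_normed_div_algebra, comm_monoid_mult}"
  shows "norm (\<Prod>x\<in>#M. f x) = (\<Prod>x\<in>#M. norm (f x))"
  by (induction M) (simp_all add: norm_mult)

lemma ln_prod_mset:
  fixes f :: "'a \<Rightarrow> real"
  assumes "\<And>x. x \<in># M \<Longrightarrow> f x \<noteq> 0"
  shows "ln (\<Prod>x\<in>#M. f x) = (\<Sum>x\<in>#M. ln (f x))"
  using assms by (induction M) (auto simp: ln_mult)

lemma prod_mset_nonneg:
  fixes f :: "'a \<Rightarrow> 'b :: linordered_semidom"
  assumes "\<And>x. x \<in># M \<Longrightarrow> 0 \<le> f x"
  shows "0 \<le> (\<Prod>x\<in>#M. f x)"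
  using assms by (induction M) auto

lemma prod_mset_pos:
  fixes f :: "'a \<Rightarrow> 'b :: linordered_semidom"
  assumes "\<And>x. x \<in># M \<Longrightarrow> 0 < f x"
  shows "0 < (\<Prod>x\<in>#M. f x)"
  using assms by (induction M) auto

lemma prod_mset_mono:
  fixes f g :: "'a \<Rightarrow> 'b :: linordered_semidom"
  assumes "\<And>x. x \<in># M \<Longrightarrow> 0 \<le> f x" "\<And>x. x \<in># M \<Longrightarrow> f x \<le> g x"
  shows "(\<Prod>x\<in>#M. f x) \<le> (\<Prod>x\<in>#M. g x)"
  using assms
proof (induction M)
  case (add x M)
  have "0 \<le> (\<Prod>x\<in>#M. f x)"
    by (rule prod_mset_nonneg) (use add.prems in simp)
  moreover have "0 \<le> g x"
    using add.prems[of x] by (metis order_trans union_single_eq_member)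
  ultimately show ?case
    using add by (simp add: mult_mono)
qed simp

lemma poly_eq_prod_proots:
  fixes p :: "complex poly"
  shows "poly p w = lead_coeff p * (\<Prod>z\<in>#proots p. w - z)"
proof -
  have "poly (\<Prod>z\<in>#M. [:- z, 1:]) w = (\<Prod>z\<in>#M. w - z)" for M :: "complex multiset"
    by (induction M) (simp_all add: algebra_simps)
  then show ?thesis
    using complex_poly_decompose_multiset[of p] by (metis poly_smult)
qed

lemma integral_pmf_of_multiset:
  fixes f :: "'a \<Rightarrow> 'b :: {banach, second_countable_topology}"
  assumes "M \<noteq> {#}"
  shows "(\<integral>x. f x \<partial>pmf_of_multiset M) = (\<Sum>x\<in>#M. f x) /\<^sub>R real (size M)"
proof -
  obtain xs where xs: "mset xs = M" using ex_mset by blast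
  define n where "n = length xs"
  have M: "M = image_mset ((!) xs) (mset_set {..<n})"
    using xs by (metis n_def map_nth mset_map mset_upt atLeast0LessThan)
  have n: "{..<n} \<noteq> {}" using assms M by auto
  then have "pmf_of_multiset M = map_pmf ((!) xs) (pmf_of_set {..<n})"
    unfolding M by (intro map_pmf_of_set [symmetric]) auto
  then have "(\<integral>x. f x \<partial>pmf_of_multiset M) = (\<integral>i. f (xs ! i) \<partial>pmf_of_set {..<n})"
    by simp
  also have "\<dots> = (\<Sum>i<n. f (xs ! i)) /\<^sub>R real n"
    using n
    by (subst integral_measure_pmf[of "{..<n}"]) (auto simp: inverse_eq_divide scaleR_sum_right)
  also have "(\<Sum>i<n. f (xs ! i)) = (\<Sum>x\<in>#M. f x)"
    unfolding M by (simp add: sum_unfold_sum_mset image_mset.compositionality o_def)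
  also have "n = size M"
    unfolding M by simp
  finally show ?thesis .
qed

text \<open>Reflecting in the circle the points inside it does not change the modulus of the product on
  the circle, and the maximum principle is then applied at the origin. This replaces Jensen's
  formula.\<close>

lemma prod_max_norm_le_sup_circle:
  fixes Z :: "complex multiset"
  assumes "\<rho> > 0" and bound: "\<And>w. norm w = \<rho> \<Longrightarrow> norm (\<Prod>z\<in>#Z. w - z) \<le> B"
  shows "(\<Prod>z\<in>#Z. max (norm z) \<rho>) \<le> B"
proof -
  define factor where
    "factor z w = (if norm z \<le> \<rho> then (\<rho>\<^sup>2 - cnj z * w) / \<rho> else w - z)" for z w
  have norm_factor: "norm (factor z w) = norm (w - z)" if "norm w = \<rho>" for z w
  proof -
    have "\<rho>\<^sup>2 - cnj z * w = cnj (w - z) * w"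
      using that complex_norm_square[of w] by (simp add: algebra_simps)
    then have "norm (\<rho>\<^sup>2 - cnj z * w) = norm (w - z) * \<rho>"
      using that by (simp add: norm_mult del: complex_cnj_diff)
    then show ?thesis
      using assms(1) by (simp add: factor_def norm_divide)
  qed
  have "factor z holomorphic_on UNIV" for z
    using assms(1) unfolding factor_def [abs_def]
    by (cases "norm z \<le> \<rho>") (auto intro!: holomorphic_intros)
  then have "(\<lambda>w. \<Prod>z\<in>#Z. factor z w) holomorphic_on UNIV"
    by (induction Z) (simp_all add: holomorphic_on_mult)
  then have "(\<lambda>w. \<Prod>z\<in>#Z. factor z w) holomorphic_on interior (cball 0 \<rho>)"
    "continuous_on (closure (cball 0 \<rho>)) (\<lambda>w. \<Prod>z\<in>#Z. factor z w)"
    using holomorphic_on_subset holomorphic_on_imp_continuous_on by blast+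
  moreover have "norm (\<Prod>z\<in>#Z. factor z w) \<le> B" if "w \<in> frontier (cball 0 \<rho>)" for w
    using that bound[of w] by (simp add: norm_prod_mset norm_factor)
  ultimately have "norm (\<Prod>z\<in>#Z. factor z 0) \<le> B"
    by (rule maximum_modulus_frontier[OF _ _ bounded_cball]) (use assms(1) in simp_all)
  moreover have "norm (factor z 0) = max (norm z) \<rho>" for z
    using assms(1) by (auto simp: factor_def norm_divide norm_power power2_eq_square)
  ultimately show ?thesis by (simp add: norm_prod_mset)
qed

section \<open>Power sums from a logarithm\<close>

lemma has_field_derivative_prod_mset_one_minus:
  fixes C :: "complex multiset"
  assumes "\<And>c. c \<in># C \<Longrightarrow> 1 - c * w \<noteq> 0"
  shows "((\<lambda>w. \<Prod>c\<in>#C. 1 - c * w) has_field_derivative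
    - (\<Prod>c\<in>#C. 1 - c * w) * (\<Sum>c\<in>#C. c / (1 - c * w))) (at w)"
  using assms
proof (induction C)
  case (add c C)
  then have "1 - c * w \<noteq> 0" by simp
  then show ?case using add
    by (auto intro!: derivative_eq_intros simp: field_simps)
qed simp

lemma has_fps_expansion_geometric:
  fixes c :: complex
  shows "(\<lambda>w. c / (1 - c * w)) has_fps_expansion Abs_fps (\<lambda>k. c ^ Suc k)"
proof -
  let ?D = "1 - fps_const c * fps_X" and ?G = "Abs_fps (\<lambda>k. c ^ Suc k)"
  have "?G * ?D = ?G - fps_const c * (fps_X * ?G)"
    by (simp only: right_diff_distrib mult_1_left mult_1_right mult_ac)
  also have "\<dots> = fps_const c"
  proof (rule fps_ext)
    show "fps_nth (?G - fps_const c * (fps_X * ?G)) n = fps_nth (fps_const c) n" for n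
      by (cases n) simp_all
  qed
  finally have "?G * ?D = fps_const c" .
  moreover have "fps_nth ?D 0 \<noteq> 0" by simp
  then have "?D \<noteq> 0" by (metis fps_zero_nth)
  ultimately have "fps_const c / ?D = ?G"
    by (metis nonzero_mult_div_cancel_right)
  moreover have "(\<lambda>w. c / (1 - c * w)) has_fps_expansion fps_const c / ?D"
    by (rule has_fps_expansion_divide' has_fps_expansion_const has_fps_expansion_diff
        has_fps_expansion_1 has_fps_expansion_mult has_fps_expansion_fps_X)+ simp
  ultimately show ?thesis by simp
qed

lemma has_fps_expansion_sum_mset_geometric:
  fixes C :: "complex multiset"
  shows "(\<lambda>w. \<Sum>c\<in>#C. c / (1 - c * w)) has_fps_expansion Abs_fps (\<lambda>k. \<Sum>c\<in>#C. c ^ Suc k)"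
proof (induction C)
  case (add c C)
  have "Abs_fps (\<lambda>k. \<Sum>c\<in>#add_mset c C. c ^ Suc k)
      = Abs_fps (\<lambda>k. c ^ Suc k) + Abs_fps (\<lambda>k. \<Sum>c\<in>#C. c ^ Suc k)"
    by (simp add: fps_eq_iff)
  then show ?case
    using has_fps_expansion_add[OF has_fps_expansion_geometric add.IH] by simp
qed (simp add: fps_zero_def [symmetric])

lemma deriv_log_prod_mset:
  fixes C :: "complex multiset"
  assumes "open S" "L holomorphic_on S"
    and exp_L: "\<And>w. w \<in> S \<Longrightarrow> exp (L w) = (\<Prod>c\<in>#C. 1 - c * w)"
    and "w \<in> S"
  shows "deriv L w = - (\<Sum>c\<in>#C. c / (1 - c * w))"
proof -
  let ?P = "\<lambda>w. \<Prod>c\<in>#C. 1 - c * w"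
  have "?P w \<noteq> 0"
    using exp_L[OF \<open>w \<in> S\<close>] by (metis exp_not_eq_zero)
  then have "1 - c * w \<noteq> 0" if "c \<in># C" for c
    using that by auto
  then have "(?P has_field_derivative - ?P w * (\<Sum>c\<in>#C. c / (1 - c * w))) (at w)"
    by (rule has_field_derivative_prod_mset_one_minus)
  moreover have "(?P has_field_derivative ?P w * deriv L w) (at w)"
  proof (rule has_field_derivative_transform_within_open)
    show "((\<lambda>w. exp (L w)) has_field_derivative ?P w * deriv L w) (at w)"
      using holomorphic_derivI[OF assms(2,1,4)] exp_L[OF \<open>w \<in> S\<close>]
      by (auto intro!: derivative_eq_intros)
  qed (use assms in auto)
  ultimately have "- ?P w * (\<Sum>c\<in>#C. c / (1 - c * w)) = ?P w * deriv L w"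
    by (rule DERIV_unique)
  then have "?P w * (- (\<Sum>c\<in>#C. c / (1 - c * w))) = ?P w * deriv L w"
    by simp
  then show ?thesis
    using \<open>?P w \<noteq> 0\<close> by (metis mult_left_cancel)
qed

lemma fps_deriv_log_prod_mset:
  fixes C :: "complex multiset"
  assumes "open S" "0 \<in> S" "L holomorphic_on S"
    and exp_L: "\<And>w. w \<in> S \<Longrightarrow> exp (L w) = (\<Prod>c\<in>#C. 1 - c * w)"
  shows "fps_deriv (fps_expansion L 0) = - Abs_fps (\<lambda>k. \<Sum>c\<in>#C. c ^ Suc k)"
proof (rule fps_expansion_unique_complex)
  show "deriv L has_fps_expansion fps_deriv (fps_expansion L 0)"
    using assms(1-3) by (intro has_fps_expansion_deriv has_fps_expansion_fps_expansion)
  have "eventually (\<lambda>w. w \<in> S) (nhds 0)"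
    using assms(1,2) by (rule eventually_nhds_in_open)
  then have "eventually (\<lambda>w. deriv L w = - (\<Sum>c\<in>#C. c / (1 - c * w))) (nhds 0)"
    by eventually_elim (rule deriv_log_prod_mset[OF assms(1,3) exp_L])
  then show "deriv L has_fps_expansion - Abs_fps (\<lambda>k. \<Sum>c\<in>#C. c ^ Suc k)"
    using has_fps_expansion_minus[OF has_fps_expansion_sum_mset_geometric]
    by (subst has_fps_expansion_cong) auto
qed

text \<open>Up to the factor \<open>- 1 / k\<close>, the power sums are the Taylor coefficients of the logarithm,
  which Cauchy's inequality bounds.\<close>

lemma norm_power_sum_le_of_log:
  fixes C :: "complex multiset" and B :: real
  assumes S: "open S" "cball 0 \<rho> \<subseteq> S" "\<rho> > 0" and L: "L holomorphic_on S"
    and exp_L: "\<And>w. w \<in> S \<Longrightarrow> exp (L w) = (\<Prod>c\<in>#C. 1 - c * w)"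
    and bound: "\<And>w. norm w = \<rho> \<Longrightarrow> norm (L w) \<le> B"
  shows "norm (\<Sum>c\<in>#C. c ^ Suc k) \<le> Suc k * B / \<rho> ^ Suc k"
proof -
  have "0 \<in> S" using S by auto
  have "of_nat (Suc k) * fps_nth (fps_expansion L 0) (Suc k) = - (\<Sum>c\<in>#C. c ^ Suc k)"
    using fps_deriv_log_prod_mset[OF S(1) \<open>0 \<in> S\<close> L exp_L]
    by (simp add: fps_eq_iff del: of_nat_Suc)
  then have "norm (\<Sum>c\<in>#C. c ^ Suc k) = Suc k * norm (fps_nth (fps_expansion L 0) (Suc k))"
    by (metis norm_minus_cancel norm_mult norm_of_nat)
  also have "fps_nth (fps_expansion L 0) (Suc k) = (deriv ^^ Suc k) L 0 / fact (Suc k)"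
    by (simp add: fps_expansion_def)
  also have "norm ((deriv ^^ Suc k) L 0) \<le> fact (Suc k) * B / \<rho> ^ Suc k"
  proof (rule Cauchy_inequality)
    show "L holomorphic_on ball 0 \<rho>"
      using S(2) ball_subset_cball by (blast intro: holomorphic_on_subset[OF L])
    show "continuous_on (cball 0 \<rho>) L"
      using continuous_on_subset[OF holomorphic_on_imp_continuous_on[OF L] S(2)] .
  qed (use S(3) bound in auto)
  then have "norm ((deriv ^^ Suc k) L 0 / fact (Suc k)) \<le> B / \<rho> ^ Suc k"
    by (simp add: norm_divide field_simps del: fact_Suc funpow.simps)
  then have "Suc k * norm ((deriv ^^ Suc k) L 0 / fact (Suc k)) \<le> Suc k * (B / \<rho> ^ Suc k)"
    by (intro mult_left_mono) auto
  finally show ?thesis by simp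
qed

section \<open>Equidistribution on a circle\<close>

inductive conj_polynomial_function :: "(complex \<Rightarrow> complex) \<Rightarrow> bool" where
  monomial: "conj_polynomial_function (\<lambda>z. c * (z ^ a * cnj z ^ b))"
| add: "conj_polynomial_function f \<Longrightarrow> conj_polynomial_function g
    \<Longrightarrow> conj_polynomial_function (\<lambda>z. f z + g z)"

lemma conj_polynomial_function_mult:
  assumes "conj_polynomial_function f" "conj_polynomial_function g"
  shows "conj_polynomial_function (\<lambda>z. f z * g z)"
  using assms
proof (induction f)
  case (monomial c a b)
  from \<open>conj_polynomial_function g\<close> show ?case
  proof (induction g)
    case (monomial c' a' b')
    have "(\<lambda>z. c * (z ^ a * cnj z ^ b) * (c' * (z ^ a' * cnj z ^ b')))
        = (\<lambda>z. (c * c') * (z ^ (a + a') * cnj z ^ (b + b')))"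
      by (simp add: power_add mult_ac)
    then show ?case using conj_polynomial_function.monomial by metis
  next
    case (add f g)
    then show ?case by (auto simp: distrib_left intro: conj_polynomial_function.add)
  qed
next
  case (add f1 f2)
  then show ?case by (auto simp: distrib_right intro: conj_polynomial_function.add)
qed

lemma conj_polynomial_function_of_real_polynomial_function:
  assumes "real_polynomial_function g"
  shows "conj_polynomial_function (\<lambda>z. complex_of_real (g z))"
  using assms
proof (induction g)
  case (linear f)
  interpret bounded_linear f by fact
  define c where "c = (complex_of_real (f 1) - \<i> * complex_of_real (f \<i>)) / 2"
  have "complex_of_real (f z) = c * (z ^ 1 * cnj z ^ 0) + cnj c * (z ^ 0 * cnj z ^ 1)" for z
  proof -
    have "z = Re z *\<^sub>R 1 + Im z *\<^sub>R \<i>" by (simp add: complex_eq_iff)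
    then have "f z = Re z * f 1 + Im z * f \<i>" by (metis add scaleR real_scaleR_def)
    then show ?thesis by (simp add: c_def complex_eq_iff field_simps)
  qed
  then show ?case
    using conj_polynomial_function.intros(2)[OF conj_polynomial_function.intros(1,1),
        of c 1 0 "cnj c" 0 1] by simp
next
  case (const c)
  show ?case using conj_polynomial_function.monomial[of "complex_of_real c" 0 0] by simp
next
  case (add f g)
  then show ?case by (simp add: conj_polynomial_function.add)
next
  case (mult f g)
  then show ?case by (simp add: conj_polynomial_function_mult)
qed

lemma continuous_on_conj_polynomial_function:
  "conj_polynomial_function f \<Longrightarrow> continuous_on A f"
  by (induction rule: conj_polynomial_function.induct) (auto intro!: continuous_intros)

lemma norm_mixed_power_diff_le:
  assumes "norm z \<le> 1" "0 \<le> r" "r \<le> 1"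
  shows "norm (z ^ (b + k) * cnj z ^ b - of_real r ^ (2 * b) * z ^ k)
    \<le> real (2 * b) * \<bar>norm z - r\<bar>"
proof -
  have "z ^ b * cnj z ^ b = of_real (norm z) ^ (2 * b)"
    using complex_norm_square[of z] by (simp add: power_mult flip: power_mult_distrib)
  then have "z ^ (b + k) * cnj z ^ b = of_real (norm z) ^ (2 * b) * z ^ k"
    by (simp add: power_add mult_ac)
  then have "z ^ (b + k) * cnj z ^ b - of_real r ^ (2 * b) * z ^ k
      = of_real (norm z ^ (2 * b) - r ^ (2 * b)) * z ^ k"
    by (simp add: algebra_simps)
  then have "norm (z ^ (b + k) * cnj z ^ b - of_real r ^ (2 * b) * z ^ k)
      = \<bar>norm z ^ (2 * b) - r ^ (2 * b)\<bar> * norm z ^ k"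
    by (simp only: norm_mult norm_of_real norm_power)
  also have "\<dots> \<le> \<bar>norm z ^ (2 * b) - r ^ (2 * b)\<bar>"
    using assms(1) by (intro mult_left_le power_le_one) auto
  also have "\<dots> \<le> real (2 * b) * \<bar>norm z - r\<bar>"
    using norm_power_diff[of "norm z" r "2 * b"] assms by simp
  finally show ?thesis .
qed

locale disk_prob_space = prob_space M for M :: "complex measure" +
  assumes borel_measurable_ident: "(\<lambda>z. z) \<in> borel_measurable M"
    and AE_norm_le_1: "AE z in M. norm z \<le> 1"
begin

lemma integrable_continuous:
  fixes f :: "complex \<Rightarrow> 'a :: {banach, second_countable_topology}"
  assumes "continuous_on UNIV f"
  shows "integrable M f"
proof -
  have "compact (f ` cball 0 1)"
    using assms continuous_on_subset by (intro compact_continuous_image) auto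
  then obtain B where B: "\<forall>w \<in> f ` cball 0 1. norm w \<le> B"
    using compact_imp_bounded bounded_iff by metis
  have "f \<in> borel_measurable M"
    by (rule measurable_compose[OF borel_measurable_ident borel_measurable_continuous_onI[OF assms]])
  moreover have "AE z in M. norm (f z) \<le> B"
    using AE_norm_le_1 by eventually_elim (use B in auto)
  ultimately show ?thesis by (rule integrable_const_bound[rotated])
qed

lemma norm_integral_diff_le:
  fixes f g :: "complex \<Rightarrow> 'a :: {banach, second_countable_topology}"
  assumes "continuous_on UNIV f" "continuous_on UNIV g"
    and "\<And>z. norm z \<le> 1 \<Longrightarrow> norm (f z - g z) \<le> e"
  shows "norm ((\<integral>z. f z \<partial>M) - (\<integral>z. g z \<partial>M)) \<le> e"
proof -
  have "norm ((\<integral>z. f z \<partial>M) - (\<integral>z. g z \<partial>M)) = norm (\<integral>z. f z - g z \<partial>M)"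
    using assms(1,2) by (simp add: integrable_continuous)
  also have "\<dots> \<le> (\<integral>z. norm (f z - g z) \<partial>M)"
    by (rule integral_norm_bound)
  also have "\<dots> \<le> (\<integral>z. e \<partial>M)"
    using AE_norm_le_1 assms
    by (intro integral_mono_AE integrable_continuous continuous_intros)
       (auto elim: eventually_mono)
  finally show ?thesis by (simp add: prob_space)
qed

lemma mixed_moment_approx:
  assumes "0 \<le> r" "r \<le> 1"
  shows "norm ((\<integral>z. z ^ (b + k) * cnj z ^ b \<partial>M) - of_real r ^ (2 * b) * (\<integral>z. z ^ k \<partial>M))
    \<le> real (2 * b) * (\<integral>z. \<bar>norm z - r\<bar> \<partial>M)"
proof -
  have "(\<integral>z. z ^ (b + k) * cnj z ^ b \<partial>M) - of_real r ^ (2 * b) * (\<integral>z. z ^ k \<partial>M)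
      = (\<integral>z. z ^ (b + k) * cnj z ^ b - of_real r ^ (2 * b) * z ^ k \<partial>M)"
    by (subst Bochner_Integration.integral_diff)
       (auto intro!: integrable_continuous continuous_intros)
  also have "norm \<dots> \<le> (\<integral>z. norm (z ^ (b + k) * cnj z ^ b - of_real r ^ (2 * b) * z ^ k) \<partial>M)"
    by (rule integral_norm_bound)
  also have "\<dots> \<le> (\<integral>z. real (2 * b) * \<bar>norm z - r\<bar> \<partial>M)"
    using AE_norm_le_1 norm_mixed_power_diff_le[OF _ assms]
    by (intro integral_mono_AE integrable_continuous continuous_intros)
       (auto elim: eventually_mono)
  finally show ?thesis by simp
qed

end

lemma tendsto_mixed_moment:
  fixes M :: "'i \<Rightarrow> complex measure"
  assumes M: "\<And>i. disk_prob_space (M i)" and N: "disk_prob_space N"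
    and r: "0 \<le> r" "r \<le> 1" and on_circle: "AE z in N. norm z = r"
    and radius: "((\<lambda>i. \<integral>z. \<bar>norm z - r\<bar> \<partial>M i) \<longlongrightarrow> 0) F"
    and moments: "\<And>k. ((\<lambda>i. \<integral>z. z ^ k \<partial>M i) \<longlongrightarrow> (\<integral>z. z ^ k \<partial>N)) F"
  shows "((\<lambda>i. \<integral>z. z ^ a * cnj z ^ b \<partial>M i) \<longlongrightarrow> (\<integral>z. z ^ a * cnj z ^ b \<partial>N)) F"
proof -
  have "(\<integral>z. \<bar>norm z - r\<bar> \<partial>N) = 0"
    using on_circle by (intro integral_eq_zero_AE) (auto elim: eventually_mono)
  then have N_moment: "(\<integral>z. z ^ (b + k) * cnj z ^ b \<partial>N) = of_real r ^ (2 * b) * (\<integral>z. z ^ k \<partial>N)"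
    for b k
    using disk_prob_space.mixed_moment_approx[OF N r, of b k] by simp
  have shifted: "((\<lambda>i. \<integral>z. z ^ (b + k) * cnj z ^ b \<partial>M i)
      \<longlongrightarrow> (\<integral>z. z ^ (b + k) * cnj z ^ b \<partial>N)) F" for b k
  proof (rule Lim_transform)
    show "((\<lambda>i. of_real r ^ (2 * b) * (\<integral>z. z ^ k \<partial>M i)) \<longlongrightarrow> (\<integral>z. z ^ (b + k) * cnj z ^ b \<partial>N)) F"
      unfolding N_moment by (intro tendsto_mult_left moments)
    show "((\<lambda>i. (\<integral>z. z ^ (b + k) * cnj z ^ b \<partial>M i)
        - of_real r ^ (2 * b) * (\<integral>z. z ^ k \<partial>M i)) \<longlongrightarrow> 0) F"
    proof (rule Lim_null_comparison)
      show "((\<lambda>i. real (2 * b) * (\<integral>z. \<bar>norm z - r\<bar> \<partial>M i)) \<longlongrightarrow> 0) F"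
        by (rule tendsto_mult_right_zero[OF radius])
    qed (intro always_eventually allI disk_prob_space.mixed_moment_approx M r)
  qed
  show ?thesis
  proof (cases "b \<le> a")
    case True
    then show ?thesis using shifted[of b "a - b"] by simp
  next
    case False
    then have "z ^ a * cnj z ^ b = cnj (z ^ (a + (b - a)) * cnj z ^ a)" for z
      by (simp add: mult.commute)
    then show ?thesis
      using tendsto_cnj[OF shifted[of a "b - a"]]
      by (simp only: flip: Bochner_Integration.integral_cnj)
  qed
qed

lemma tendsto_integral_conj_polynomial_function:
  fixes M :: "'i \<Rightarrow> complex measure"
  assumes M: "\<And>i. disk_prob_space (M i)" and N: "disk_prob_space N"
    and mixed_moments: "\<And>a b. ((\<lambda>i. \<integral>z. z ^ a * cnj z ^ b \<partial>M i)
      \<longlongrightarrow> (\<integral>z. z ^ a * cnj z ^ b \<partial>N)) F"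
    and "conj_polynomial_function g"
  shows "((\<lambda>i. \<integral>z. g z \<partial>M i) \<longlongrightarrow> (\<integral>z. g z \<partial>N)) F"
  using \<open>conj_polynomial_function g\<close>
proof (induction g)
  case (monomial c a b)
  show ?case unfolding integral_mult_right_zero by (intro tendsto_mult_left mixed_moments)
next
  case (add g h)
  have "(\<integral>z. g z + h z \<partial>K) = (\<integral>z. g z \<partial>K) + (\<integral>z. h z \<partial>K)" if "disk_prob_space K" for K
    by (intro Bochner_Integration.integral_add disk_prob_space.integrable_continuous that
        continuous_on_conj_polynomial_function add.hyps)
  then show ?case using tendsto_add[OF add.IH] by (simp add: M N)
qed

lemma tendsto_integral_of_mixed_moments:
  fixes M :: "'i \<Rightarrow> complex measure" and f :: "complex \<Rightarrow> real"
  assumes M: "\<And>i. disk_prob_space (M i)" and N: "disk_prob_space N"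
    and mixed_moments: "\<And>a b. ((\<lambda>i. \<integral>z. z ^ a * cnj z ^ b \<partial>M i)
      \<longlongrightarrow> (\<integral>z. z ^ a * cnj z ^ b \<partial>N)) F"
    and f: "continuous_on UNIV f"
  shows "((\<lambda>i. \<integral>z. f z \<partial>M i) \<longlongrightarrow> (\<integral>z. f z \<partial>N)) F"
proof (rule tendstoI)
  fix e :: real assume "e > 0"
  then have "e / 4 > 0" by simp
  then obtain g where g: "real_polynomial_function g" and
    "\<And>z. z \<in> cball 0 1 \<Longrightarrow> \<bar>f z - g z\<bar> < e / 4"
    using Stone_Weierstrass_real_polynomial_function[OF compact_cball continuous_on_subset[OF f]]
    by blast
  then have close: "norm (f z - g z) \<le> e / 4" if "norm z \<le> 1" for z
    using that by (simp add: less_imp_le)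
  have "continuous_on UNIV g"
    using g continuous_on_polymonial_function real_polynomial_function_eq by blast
  then have approx: "\<bar>(\<integral>z. f z \<partial>K) - (\<integral>z. g z \<partial>K)\<bar> \<le> e / 4" if "disk_prob_space K" for K
    using disk_prob_space.norm_integral_diff_le[OF that f _ close] by simp
  have "((\<lambda>i. complex_of_real (\<integral>z. g z \<partial>M i)) \<longlongrightarrow> complex_of_real (\<integral>z. g z \<partial>N)) F"
    using tendsto_integral_conj_polynomial_function[OF M N mixed_moments
        conj_polynomial_function_of_real_polynomial_function[OF g]] by simp
  then have "((\<lambda>i. \<integral>z. g z \<partial>M i) \<longlongrightarrow> (\<integral>z. g z \<partial>N)) F"
    by (simp only: tendsto_of_real_iff)
  then have "eventually (\<lambda>i. dist (\<integral>z. g z \<partial>M i) (\<integral>z. g z \<partial>N) < e / 4) F"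
    using \<open>e / 4 > 0\<close> by (rule tendstoD)
  then show "eventually (\<lambda>i. dist (\<integral>z. f z \<partial>M i) (\<integral>z. f z \<partial>N) < e) F"
  proof eventually_elim
    case (elim i)
    then show ?case
      using approx[OF M[of i]] approx[OF N] \<open>e > 0\<close> unfolding dist_real_def by linarith
  qed
qed

section \<open>The uniform measure on a circle\<close>

lemma measurable_circle_param:
  "(\<lambda>t. complex_of_real r * cis t) \<in> uniform_measure lborel {0..2 * pi} \<rightarrow>\<^sub>M borel"
proof -
  have "(\<lambda>t. complex_of_real r * cis t) \<in> borel \<rightarrow>\<^sub>M borel"
    by (intro borel_measurable_continuous_onI continuous_intros)
  then show ?thesis by (subst measurable_cong_sets[of _ borel _ borel]) auto
qed

lemma AE_circle_uniform: "AE z in circle_uniform r. norm z = \<bar>r\<bar>"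
  unfolding circle_uniform_def
  by (subst AE_distr_iff[OF measurable_circle_param]) (auto simp: norm_mult)

lemma disk_prob_space_circle_uniform:
  assumes "\<bar>r\<bar> \<le> 1"
  shows "disk_prob_space (circle_uniform r)"
proof -
  have "prob_space (uniform_measure lborel {0..2 * pi})"
    by (rule prob_space_uniform_measure) auto
  then interpret prob_space "circle_uniform r"
    unfolding circle_uniform_def
    by (rule prob_space.prob_space_distr[OF _ measurable_circle_param])
  show ?thesis
  proof
    show "(\<lambda>z. z) \<in> borel_measurable (circle_uniform r)"
      by (simp add: circle_uniform_def)
    show "AE z in circle_uniform r. norm z \<le> 1"
      using AE_circle_uniform[of r] by eventually_elim (use assms in simp)
  qed
qed

lemma integral_uniform_measure:
  fixes f :: "'a \<Rightarrow> 'b :: {banach, second_countable_topology}"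
  assumes "f \<in> borel_measurable M" "A \<in> sets M" "emeasure M A \<noteq> 0" "emeasure M A \<noteq> \<infinity>"
  shows "(\<integral>x. f x \<partial>uniform_measure M A) = (\<integral>x. indicator A x *\<^sub>R f x \<partial>M) /\<^sub>R measure M A"
proof -
  have "uniform_measure M A = density M (\<lambda>x. ennreal (indicator A x / measure M A))"
    unfolding uniform_measure_def using assms(3,4)
    by (intro arg_cong2[of _ _ _ _ density] refl ext)
       (auto simp: indicator_def divide_ennreal emeasure_eq_ennreal_measure zero_less_measure_iff
          simp flip: ennreal_1)
  then have "(\<integral>x. f x \<partial>uniform_measure M A) = (\<integral>x. (indicator A x / measure M A) *\<^sub>R f x \<partial>M)"
    using assms(1,2) by (simp add: integral_density)
  also have "\<dots> = (\<integral>x. (indicator A x *\<^sub>R f x) /\<^sub>R measure M A \<partial>M)"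
    by (simp add: divide_inverse mult.commute)
  also have "\<dots> = (\<integral>x. indicator A x *\<^sub>R f x \<partial>M) /\<^sub>R measure M A"
    by (rule integral_scaleR_right)
  finally show ?thesis .
qed

lemma integral_cis_multiple:
  assumes "k > 0"
  shows "(\<integral>t. indicator {0..2 * pi} t *\<^sub>R cis (real k * t) \<partial>lborel) = 0"
proof -
  have "(\<integral>t. indicator {0..2 * pi} t *\<^sub>R cis (real k * t) \<partial>lborel)
      = cis (real k * (2 * pi)) / (\<i> * k) - cis (real k * 0) / (\<i> * k)"
  proof (rule integral_FTC_Icc)
    fix t
    show "((\<lambda>t. cis (real k * t) / (\<i> * k)) has_vector_derivative cis (real k * t))
        (at t within {0..2 * pi})"
      unfolding has_vector_derivative_def using assms
      by (auto intro!: derivative_eq_intros simp: scaleR_conv_of_real)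
         (simp add: fun_eq_iff complex_eq_iff)
  qed (auto intro!: continuous_intros)
  moreover have "cis (real k * (2 * pi)) = 1"
    using cis_multiple_2pi[of "real k"] by (simp add: mult_ac)
  ultimately show ?thesis by simp
qed

lemma moment_circle_uniform:
  assumes "k > 0"
  shows "(\<integral>z. z ^ k \<partial>circle_uniform r) = 0"
proof -
  have "(\<integral>z. z ^ k \<partial>circle_uniform r)
      = (\<integral>t. (complex_of_real r * cis t) ^ k \<partial>uniform_measure lborel {0..2 * pi})"
    unfolding circle_uniform_def by (intro integral_distr measurable_circle_param) simp
  also have "\<dots> = of_real r ^ k * (\<integral>t. cis (real k * t) \<partial>uniform_measure lborel {0..2 * pi})"
    by (simp add: power_mult_distrib Complex.DeMoivre)
  also have "(\<integral>t. cis (real k * t) \<partial>uniform_measure lborel {0..2 * pi}) = 0"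
    by (subst integral_uniform_measure)
       (auto intro!: borel_measurable_continuous_onI continuous_intros
          simp: integral_cis_multiple[OF assms])
  finally show ?thesis by simp
qed

section \<open>Reversed polynomials\<close>

definition reversed_poly :: "complex poly \<Rightarrow> complex poly" where
  "reversed_poly p = reflect_poly (map_poly cnj p)"

lemma degree_map_poly_cnj [simp]: "degree (map_poly cnj p) = degree p"
  by (rule degree_map_poly) auto

lemma poly_reversed_poly:
  assumes "z \<noteq> 0"
  shows "poly (reversed_poly p) z = z ^ degree p * cnj (poly p (1 / cnj z))"
  using assms poly_cnj[of p "1 / cnj z"]
  by (simp add: reversed_poly_def poly_reflect_poly_nz inverse_eq_divide)

lemma poly_reversed_poly_0: "poly (reversed_poly p) 0 = cnj (lead_coeff p)"
  by (simp add: reversed_poly_def coeff_map_poly)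

lemma degree_reversed_poly_le: "degree (reversed_poly p) \<le> degree p"
  using degree_reflect_poly_le[of "map_poly cnj p"] by (simp add: reversed_poly_def)

lemma cnj_mult_self_circle:
  assumes "norm z = 1"
  shows "cnj z * z = 1"
  using assms complex_norm_square[of z] by (simp add: mult.commute)

lemma poly_reversed_poly_circle:
  assumes "norm z = 1"
  shows "poly (reversed_poly p) z = z ^ degree p * cnj (poly p z)"
proof -
  have "z \<noteq> 0" using assms by auto
  moreover have "1 / cnj z = z"
    using cnj_mult_self_circle[OF assms] by (metis inverse_unique inverse_eq_divide)
  ultimately show ?thesis using poly_reversed_poly[of z p] by simp
qed

lemma poly_reversed_poly_eq_prod:
  "poly (reversed_poly p) w = cnj (lead_coeff p) * (\<Prod>z\<in>#proots p. 1 - cnj z * w)"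
proof (cases "w = 0")
  case True
  then show ?thesis by (simp add: poly_reversed_poly_0)
next
  case False
  have "w ^ size Z * cnj (\<Prod>z\<in>#Z. 1 / cnj w - z) = (\<Prod>z\<in>#Z. 1 - cnj z * w)" for Z
  proof (induction Z)
    case (add z Z)
    have "w ^ size (add_mset z Z) * cnj (\<Prod>z\<in>#add_mset z Z. 1 / cnj w - z)
        = (w * cnj (1 / cnj w - z)) * (w ^ size Z * cnj (\<Prod>z\<in>#Z. 1 / cnj w - z))"
      by (simp add: mult_ac)
    also have "w * cnj (1 / cnj w - z) = 1 - cnj z * w"
      using False by (simp add: field_simps)
    finally show ?case unfolding add.IH by simp
  qed simp
  from this[of "proots p"] show ?thesis
    using False by (simp add: poly_reversed_poly poly_eq_prod_proots[of p] size_proots_complex)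
qed

lemma norm_diff_le_norm_one_minus_cnj_mult:
  fixes w z :: complex
  assumes "norm w \<le> 1" "norm z \<le> 1"
  shows "norm (w - z) \<le> norm (1 - cnj z * w)"
proof -
  have "(norm (1 - cnj z * w))\<^sup>2 - (norm (w - z))\<^sup>2 = (1 - (norm w)\<^sup>2) * (1 - (norm z)\<^sup>2)"
    unfolding cmod_power2 by (simp add: power2_eq_square algebra_simps)
  also have "\<dots> \<ge> 0" using assms by (simp add: abs_square_le_1)
  finally show ?thesis by (metis diff_ge_0_iff_ge norm_ge_zero power2_le_imp_le)
qed

lemma norm_poly_le_norm_reversed_poly:
  assumes "\<And>z. z \<in># proots p \<Longrightarrow> norm z \<le> 1" and "norm w \<le> 1"
  shows "norm (poly p w) \<le> norm (poly (reversed_poly p) w)"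
  unfolding poly_eq_prod_proots[of p] poly_reversed_poly_eq_prod norm_mult norm_prod_mset
  using assms
  by (auto intro!: mult_left_mono prod_mset_mono norm_diff_le_norm_one_minus_cnj_mult)

lemma reversed_poly_nonzero:
  assumes "p \<noteq> 0" "\<And>z. z \<in># proots p \<Longrightarrow> norm z < 1" and "norm w \<le> 1"
  shows "poly (reversed_poly p) w \<noteq> 0"
proof -
  have "1 - cnj z * w \<noteq> 0" if "z \<in># proots p" for z
  proof -
    have "norm (cnj z * w) < 1"
      using assms(2)[OF that] mult_left_le[OF assms(3), of "norm z"] by (simp add: norm_mult)
    then show ?thesis by fastforce
  qed
  then show ?thesis using assms(1) by (auto simp: poly_reversed_poly_eq_prod)
qed

lemma monic_szego_step:
  assumes "degree p = n" "lead_coeff p = 1"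
  shows "degree (pCons 0 p - smult c (reversed_poly p)) = Suc n"
    and "lead_coeff (pCons 0 p - smult c (reversed_poly p)) = 1"
proof -
  let ?P = "pCons 0 p - smult c (reversed_poly p)"
  have small: "degree (smult c (reversed_poly p)) \<le> n"
    using degree_reversed_poly_le[of p] assms(1) by (metis degree_smult_le le_trans)
  then have coeff: "coeff ?P (Suc n) = 1"
    using assms by (simp add: coeff_eq_0 le_imp_less_Suc del: coeff_smult)
  have "degree ?P \<le> Suc n"
    using small assms(1) by (intro degree_diff_le order_trans[OF degree_pCons_le]) auto
  then show "degree ?P = Suc n"
    using coeff by (metis le_degree le_antisym zero_neq_one)
  then show "lead_coeff ?P = 1"
    using coeff by simp
qed

section \<open>Orthogonal polynomials on the unit circle\<close>

lemma msupport_subset_closed: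
  assumes "sets M = sets borel" "closed C" "AE z in M. z \<in> C"
  shows "msupport M \<subseteq> C"
proof
  fix z assume z: "z \<in> msupport M"
  show "z \<in> C"
  proof (rule ccontr)
    assume "z \<notin> C"
    then obtain e where e: "e > 0" "ball z e \<subseteq> - C"
      using assms(2) by (metis ComplI open_Compl open_contains_ball)
    have "AE w in M. w \<notin> ball z e"
      using assms(3) by eventually_elim (use e in auto)
    then have "emeasure M (ball z e) = 0"
      using assms(1) by (metis AE_iff_null_sets null_setsD1 borel_open open_ball)
    then show False using z e(1) by (auto simp: msupport_def)
  qed
qed

locale nontrivial_circle_measure = prob_space mu for mu :: "complex measure" +
  assumes sets_borel: "sets mu = sets borel"
    and null_off_circle: "emeasure mu (- sphere 0 1) = 0"
    and infinite_support: "infinite (msupport mu)"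
begin

lemma AE_norm_eq_1: "AE z in mu. norm z = 1"
proof (rule AE_I)
  show "{z \<in> space mu. norm z \<noteq> 1} \<subseteq> - sphere 0 1" by auto
  show "- sphere 0 1 \<in> sets mu" unfolding sets_borel by auto
qed (rule null_off_circle)

sublocale disk_prob_space mu
proof
  show "(\<lambda>z. z) \<in> borel_measurable mu"
    using measurable_ident_sets[OF sets_borel] .
  show "AE z in mu. norm z \<le> 1"
    using AE_norm_eq_1 by eventually_elim simp
qed

definition ip :: "complex poly \<Rightarrow> complex poly \<Rightarrow> complex" where
  "ip p q = (\<integral>z. cnj (poly p z) * poly q z \<partial>mu)"

definition sq_norm :: "complex poly \<Rightarrow> real" where
  "sq_norm p = (\<integral>z. (norm (poly p z))\<^sup>2 \<partial>mu)"

lemma integrable_cnj_poly_mult_poly: "integrable mu (\<lambda>z. cnj (poly p z) * poly q z)"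
  by (intro integrable_continuous continuous_intros)

lemma ip_cong_circle:
  assumes "\<And>z. norm z = 1 \<Longrightarrow> cnj (poly p z) * poly q z = cnj (poly p' z) * poly q' z"
  shows "ip p q = ip p' q'"
  unfolding ip_def
proof (rule integral_cong_AE)
  show "AE z in mu. cnj (poly p z) * poly q z = cnj (poly p' z) * poly q' z"
    using AE_norm_eq_1 by eventually_elim (rule assms)
qed (auto intro: borel_measurable_integrable integrable_cnj_poly_mult_poly)

lemma ip_commute: "ip q p = cnj (ip p q)"
  unfolding ip_def by (simp add: mult.commute flip: Bochner_Integration.integral_cnj)

lemma ip_add_right: "ip p (q + q') = ip p q + ip p q'"
  unfolding ip_def
  by (subst Bochner_Integration.integral_add [symmetric])
     (simp_all add: integrable_cnj_poly_mult_poly distrib_left)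

lemma ip_smult_right: "ip p (smult c q) = c * ip p q"
  unfolding ip_def by (simp add: mult_ac flip: integral_mult_right_zero)

lemma ip_diff_right: "ip p (q - q') = ip p q - ip p q'"
  using ip_add_right[of p "q - q'" q'] by simp

lemma ip_add_left: "ip (p + p') q = ip p q + ip p' q"
  by (metis ip_commute ip_add_right complex_cnj_add)

lemma ip_smult_left: "ip (smult c p) q = cnj c * ip p q"
  by (metis ip_commute ip_smult_right complex_cnj_mult)

lemma ip_eq_sum_monom: "ip p q = (\<Sum>i\<le>degree p. cnj (coeff p i) * ip (monom 1 i) q)"
proof -
  have "ip p q = (\<integral>z. (\<Sum>i\<le>degree p. cnj (coeff p i) * (cnj (poly (monom 1 i) z) * poly q z)) \<partial>mu)"
    by (simp add: ip_def poly_altdef[of p] poly_monom sum_distrib_right mult.assoc)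
  also have "\<dots> = (\<Sum>i\<le>degree p. cnj (coeff p i) * ip (monom 1 i) q)"
    by (subst Bochner_Integration.integral_sum)
       (auto simp: ip_def intro: integrable_mult_right integrable_cnj_poly_mult_poly)
  finally show ?thesis .
qed

lemma ip_pCons_0: "ip (pCons 0 p) (pCons 0 q) = ip p q"
proof (rule ip_cong_circle)
  fix z :: complex assume "norm z = 1"
  then have "(cnj z * z) * (cnj (poly p z) * poly q z) = cnj (poly p z) * poly q z"
    by (simp only: cnj_mult_self_circle mult_1_left)
  then show "cnj (poly (pCons 0 p) z) * poly (pCons 0 q) z = cnj (poly p z) * poly q z"
    by (simp add: mult_ac)
qed

lemma ip_monom_reversed_poly:
  assumes "j \<le> degree p"
  shows "ip (monom 1 j) (reversed_poly p) = ip p (monom 1 (degree p - j))"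
proof (rule ip_cong_circle)
  fix z :: complex assume "norm z = 1"
  then have "cnj z ^ j * z ^ j = 1"
    by (metis cnj_mult_self_circle power_mult_distrib power_one)
  then have "cnj z ^ j * z ^ degree p = z ^ (degree p - j)"
    using assms by (metis le_add_diff_inverse mult.assoc mult_1 power_add)
  then have "cnj z ^ j * (z ^ degree p * cnj (poly p z)) = cnj (poly p z) * z ^ (degree p - j)"
    by (metis mult.assoc mult.commute)
  then show "cnj (poly (monom 1 j) z) * poly (reversed_poly p) z
      = cnj (poly p z) * poly (monom 1 (degree p - j)) z"
    using \<open>norm z = 1\<close> by (simp add: poly_monom poly_reversed_poly_circle)
qed

lemma integrable_norm_poly_sq: "integrable mu (\<lambda>z. (norm (poly p z))\<^sup>2)"
  by (intro integrable_continuous continuous_intros)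

lemma ip_self: "ip p p = of_real (sq_norm p)"
proof -
  have "ip p p = (\<integral>z. complex_of_real ((norm (poly p z))\<^sup>2) \<partial>mu)"
    unfolding ip_def
    by (intro Bochner_Integration.integral_cong refl)
       (metis complex_norm_square mult.commute of_real_power)
  then show ?thesis by (simp only: integral_complex_of_real sq_norm_def)
qed

lemma sq_norm_pos:
  assumes "p \<noteq> 0"
  shows "sq_norm p > 0"
proof (rule ccontr)
  assume "\<not> sq_norm p > 0"
  moreover have "sq_norm p \<ge> 0" by (simp add: sq_norm_def)
  ultimately have "(\<integral>z. (norm (poly p z))\<^sup>2 \<partial>mu) = 0" unfolding sq_norm_def by linarith
  then have "AE z in mu. poly p z = 0"
    using integral_nonneg_eq_0_iff_AE[OF integrable_norm_poly_sq] by simp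
  moreover have "finite {z. poly p z = 0}"
    using assms by (rule poly_roots_finite)
  ultimately have "msupport mu \<subseteq> {z. poly p z = 0}"
    by (intro msupport_subset_closed sets_borel finite_imp_closed) auto
  then show False
    using infinite_support \<open>finite {z. poly p z = 0}\<close> finite_subset by blast
qed

definition orth_below :: "nat \<Rightarrow> complex poly \<Rightarrow> bool" where
  "orth_below n p \<longleftrightarrow> (\<forall>j<n. ip (monom 1 j) p = 0)"

lemma ip_orth_below:
  assumes "orth_below n p" "\<And>i. i \<ge> n \<Longrightarrow> coeff q i = 0"
  shows "ip q p = 0"
  unfolding ip_eq_sum_monom[of q p]
proof (intro sum.neutral ballI)
  fix i
  show "cnj (coeff q i) * ip (monom 1 i) p = 0"
    using assms by (cases "i < n") (auto simp: orth_below_def)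
qed

lemma orth_below_imp_zero:
  assumes "orth_below n q" "\<And>i. i \<ge> n \<Longrightarrow> coeff q i = 0"
  shows "q = 0"
  using ip_orth_below[OF assms] sq_norm_pos[of q] ip_self[of q] by fastforce

definition monic_orth :: "nat \<Rightarrow> complex poly \<Rightarrow> bool" where
  "monic_orth n p \<longleftrightarrow> degree p = n \<and> lead_coeff p = 1 \<and> orth_below n p"

lemma monic_orth_unique:
  assumes "monic_orth n p" "monic_orth n q"
  shows "p = q"
proof -
  have "orth_below n (p - q)"
    using assms by (simp add: monic_orth_def orth_below_def ip_diff_right)
  moreover have "coeff (p - q) i = 0" if "i \<ge> n" for i
    using assms that by (cases "i = n") (auto simp: monic_orth_def coeff_eq_0)
  ultimately have "p - q = 0" by (rule orth_below_imp_zero)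
  then show ?thesis by simp
qed

lemma ip_monom_monic_orth:
  assumes "monic_orth n p"
  shows "ip p (monom 1 n) = of_real (sq_norm p)"
proof -
  have "coeff (p - monom 1 n) i = 0" if "i \<ge> n" for i
    using assms that by (cases "i = n") (auto simp: monic_orth_def coeff_eq_0)
  then have "ip (p - monom 1 n) p = 0"
    using assms by (intro ip_orth_below[of n]) (simp_all add: monic_orth_def)
  then have "ip p (p - monom 1 n) = 0"
    using ip_commute[of p "p - monom 1 n"] by simp
  then show ?thesis by (simp add: ip_diff_right ip_self)
qed

lemma monic_orth_Suc:
  assumes "monic_orth n p"
  shows "\<exists>c. monic_orth (Suc n) (pCons 0 p - smult c (reversed_poly p))"
proof -
  have p: "degree p = n" "lead_coeff p = 1" "orth_below n p"
    using assms by (auto simp: monic_orth_def)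
  have nonzero: "ip (monom 1 0) (reversed_poly p) \<noteq> 0"
    using ip_monom_reversed_poly[of 0 p] ip_monom_monic_orth[OF assms] sq_norm_pos[of p] p
    by fastforce
  define c where "c = ip (monom 1 0) (pCons 0 p) / ip (monom 1 0) (reversed_poly p)"
  have "ip (monom 1 j) (pCons 0 p - smult c (reversed_poly p)) = 0" if "j < Suc n" for j
  proof (cases j)
    case 0
    then show ?thesis using nonzero by (simp add: ip_diff_right ip_smult_right c_def)
  next
    case (Suc i)
    then have "ip (monom 1 j) (pCons 0 p) = 0"
      using p(3) that ip_pCons_0[of "monom 1 i" p] by (simp add: monom_Suc orth_below_def)
    moreover have "ip (monom 1 (n - j)) p = 0"
      using p(3) that Suc by (simp add: orth_below_def)
    then have "ip (monom 1 j) (reversed_poly p) = 0"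
      using ip_monom_reversed_poly[of j p] ip_commute[of p] p(1) that by simp
    ultimately show ?thesis by (simp add: ip_diff_right ip_smult_right)
  qed
  then have "monic_orth (Suc n) (pCons 0 p - smult c (reversed_poly p))"
    using monic_szego_step[OF p(1,2)] by (simp add: monic_orth_def orth_below_def)
  then show ?thesis ..
qed

lemma monic_orth_0: "monic_orth 0 1"
  by (simp add: monic_orth_def orth_below_def)

lemma monic_orth_exists: "\<exists>p. monic_orth n p"
  by (induction n) (use monic_orth_0 monic_orth_Suc in blast)+

abbreviation "\<Phi> \<equiv> OPUC mu"
abbreviation "\<alpha> \<equiv> verblunsky mu"
abbreviation "rev\<Phi> n \<equiv> reversed_poly (\<Phi> n)"

lemma monic_orth_OPUC: "monic_orth n (\<Phi> n)"
proof -
  have "\<Phi> n = (THE p. monic_orth n p)"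
    unfolding OPUC_def monic_orth_def orth_below_def ip_def by (simp add: poly_monom)
  then show ?thesis using monic_orth_exists monic_orth_unique by (metis theI')
qed

lemma degree_OPUC [simp]: "degree (\<Phi> n) = n"
  and coeff_OPUC_self [simp]: "coeff (\<Phi> n) n = 1"
  and orth_below_OPUC: "orth_below n (\<Phi> n)"
  using monic_orth_OPUC[of n] by (auto simp: monic_orth_def)

lemma OPUC_nonzero [simp]: "\<Phi> n \<noteq> 0"
  using coeff_OPUC_self[of n] by fastforce

lemma OPUC_0 [simp]: "\<Phi> 0 = 1"
  using monic_orth_unique[OF monic_orth_OPUC monic_orth_0] .

lemma poly_OPUC_Suc:
  "poly (\<Phi> (Suc n)) z = z * poly (\<Phi> n) z - cnj (\<alpha> n) * poly (rev\<Phi> n) z"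
proof -
  obtain c where eq: "\<Phi> (Suc n) = pCons 0 (\<Phi> n) - smult c (rev\<Phi> n)"
    using monic_orth_Suc[OF monic_orth_OPUC] monic_orth_unique[OF monic_orth_OPUC] by blast
  have "poly (\<Phi> (Suc n)) 0 = - c"
    unfolding eq by (simp add: poly_reversed_poly_0)
  then have "c = cnj (\<alpha> n)" by (simp add: verblunsky_def)
  then show ?thesis by (simp add: eq)
qed

lemma poly_reversed_OPUC_Suc:
  "poly (rev\<Phi> (Suc n)) z = poly (rev\<Phi> n) z - \<alpha> n * z * poly (\<Phi> n) z"
proof (cases "z = 0")
  case True
  then show ?thesis by (simp add: poly_reversed_poly_0)
next
  case False
  then have "cnj (poly (rev\<Phi> n) (1 / cnj z)) = poly (\<Phi> n) z / z ^ n"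
    using poly_reversed_poly[of "1 / cnj z" "\<Phi> n"] by (simp add: power_divide)
  then show ?thesis
    using False by (simp add: poly_reversed_poly poly_OPUC_Suc field_simps)
qed

text \<open>If \<open>\<Phi>\<^sub>n = (z - w) q\<close>, then \<open>z q = \<Phi>\<^sub>n + w q\<close> is an orthogonal decomposition, and
  \<open>z q\<close> has the same norm as \<open>q\<close>.\<close>

lemma OPUC_zero_in_disk:
  assumes "poly (\<Phi> n) w = 0"
  shows "norm w < 1"
proof -
  obtain q where q: "\<Phi> n = [:-w, 1:] * q"
    using assms by (metis dvdE poly_eq_0_iff_dvd)
  then have "q \<noteq> 0" by (metis OPUC_nonzero mult_zero_right)
  have "degree (\<Phi> n) = Suc (degree q)"
    unfolding q using \<open>q \<noteq> 0\<close> degree_mult_eq[of "[:-w, 1:]" q] by simp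
  then have "ip q (\<Phi> n) = 0"
    by (intro ip_orth_below[OF orth_below_OPUC]) (simp add: coeff_eq_0)
  moreover from this have "ip (\<Phi> n) q = 0"
    using ip_commute[of "\<Phi> n" q] by simp
  moreover have "pCons 0 q = \<Phi> n + smult w q"
    by (simp add: q)
  ultimately have "ip q q = ip (\<Phi> n) (\<Phi> n) + cnj w * w * ip q q"
    using ip_pCons_0[of q q]
    by (simp add: ip_add_left ip_add_right ip_smult_left ip_smult_right mult_ac)
  then have "complex_of_real (sq_norm q) = of_real (sq_norm (\<Phi> n) + (norm w)\<^sup>2 * sq_norm q)"
    using complex_norm_square[of w] by (simp add: ip_self mult.commute)
  then have "sq_norm q * (1 - (norm w)\<^sup>2) = sq_norm (\<Phi> n)"
    unfolding of_real_eq_iff by (simp add: algebra_simps)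
  moreover have "sq_norm (\<Phi> n) > 0" "sq_norm q > 0"
    using sq_norm_pos \<open>q \<noteq> 0\<close> by auto
  ultimately have "1 - (norm w)\<^sup>2 > 0" by (metis zero_less_mult_pos)
  then show ?thesis by (simp add: abs_square_less_1)
qed

lemma norm_proots_OPUC_less_1: "z \<in># proots (\<Phi> n) \<Longrightarrow> norm z < 1"
  using OPUC_zero_in_disk by simp

lemma size_proots_OPUC [simp]: "size (proots (\<Phi> n)) = n"
  by (simp add: size_proots_complex)

lemma norm_verblunsky_eq_prod_zeros: "norm (\<alpha> n) = (\<Prod>z\<in>#proots (\<Phi> (Suc n)). norm z)"
  by (simp add: verblunsky_def poly_eq_prod_proots[of "\<Phi> (Suc n)"] norm_prod_mset)

lemma norm_verblunsky_less_1: "norm (\<alpha> n) < 1"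
proof -
  obtain z Z where Z: "proots (\<Phi> (Suc n)) = add_mset z Z"
    using size_proots_OPUC[of "Suc n"] by (metis size_eq_Suc_imp_eq_union)
  then have less_1: "norm x < 1" if "x = z \<or> x \<in># Z" for x
    using norm_proots_OPUC_less_1[of x "Suc n"] that by simp
  then have "(\<Prod>x\<in>#Z. norm x) \<le> (\<Prod>x\<in>#Z. 1)"
    by (intro prod_mset_mono) (auto intro: less_imp_le)
  moreover have "norm z < 1" using less_1 by simp
  ultimately have "norm z * (\<Prod>x\<in>#Z. norm x) < 1"
    using mult_left_le[of "\<Prod>x\<in>#Z. norm x" "norm z"] by simp
  then show ?thesis by (simp add: norm_verblunsky_eq_prod_zeros Z)
qed

definition blaschke :: "nat \<Rightarrow> complex \<Rightarrow> complex" where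
  "blaschke n w = poly (\<Phi> n) w / poly (rev\<Phi> n) w"

lemma reversed_OPUC_nonzero: "norm w \<le> 1 \<Longrightarrow> poly (rev\<Phi> n) w \<noteq> 0"
  using norm_proots_OPUC_less_1 by (intro reversed_poly_nonzero) simp_all

lemma norm_blaschke_le_1:
  assumes "norm w \<le> 1"
  shows "norm (blaschke n w) \<le> 1"
proof -
  have "norm (poly (\<Phi> n) w) \<le> norm (poly (rev\<Phi> n) w)"
    by (rule norm_poly_le_norm_reversed_poly[OF less_imp_le[OF norm_proots_OPUC_less_1] assms])
  then show ?thesis
    using reversed_OPUC_nonzero[OF assms, of n] by (simp add: blaschke_def norm_divide)
qed

lemma norm_verblunsky_blaschke_le:
  assumes "norm w \<le> 1"
  shows "norm (\<alpha> j * w * blaschke j w) \<le> norm (\<alpha> j) * norm w"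
  using norm_blaschke_le_1[OF assms] by (simp add: norm_mult mult_left_le)

lemma reversed_OPUC_eq_prod:
  assumes "norm w \<le> 1"
  shows "poly (rev\<Phi> n) w = (\<Prod>j<n. 1 - \<alpha> j * w * blaschke j w)"
proof (induction n)
  case 0
  then show ?case by (simp add: poly_reversed_poly_eq_prod)
next
  case (Suc n)
  have "poly (rev\<Phi> (Suc n)) w = poly (rev\<Phi> n) w * (1 - \<alpha> n * w * blaschke n w)"
    using reversed_OPUC_nonzero[OF assms]
    by (simp add: poly_reversed_OPUC_Suc blaschke_def field_simps)
  then show ?case by (simp add: Suc)
qed

lemma norm_reversed_OPUC_le:
  assumes "norm w \<le> 1"
  shows "norm (poly (rev\<Phi> n) w) \<le> exp (\<Sum>j<n. norm (\<alpha> j))"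
proof -
  have "norm (1 - \<alpha> j * w * blaschke j w) \<le> exp (norm (\<alpha> j))" for j
  proof -
    have "norm (1 - \<alpha> j * w * blaschke j w) \<le> 1 + norm (\<alpha> j * w * blaschke j w)"
      by (metis norm_one norm_triangle_ineq4)
    also have "\<dots> \<le> 1 + norm (\<alpha> j)"
      using norm_verblunsky_blaschke_le[OF assms, of j] mult_left_le[OF assms, of "norm (\<alpha> j)"]
      by simp
    also have "\<dots> \<le> exp (norm (\<alpha> j))"
      by (rule exp_ge_add_one_self)
    finally show ?thesis .
  qed
  then show ?thesis
    unfolding reversed_OPUC_eq_prod[OF assms]
    by (simp add: exp_sum prod_norm [symmetric] prod_mono)
qed

lemma norm_OPUC_Suc_le:
  assumes "norm w \<le> 1"
  shows "norm (poly (\<Phi> (Suc n)) w)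
    \<le> norm w * norm (poly (\<Phi> n) w) + norm (\<alpha> n) * exp (\<Sum>j<n. norm (\<alpha> j))"
proof -
  have "norm (poly (\<Phi> (Suc n)) w)
      \<le> norm w * norm (poly (\<Phi> n) w) + norm (\<alpha> n) * norm (poly (rev\<Phi> n) w)"
    unfolding poly_OPUC_Suc by (metis complex_mod_cnj norm_mult norm_triangle_ineq4)
  also have "\<dots> \<le> norm w * norm (poly (\<Phi> n) w) + norm (\<alpha> n) * exp (\<Sum>j<n. norm (\<alpha> j))"
    using norm_reversed_OPUC_le[OF assms] by (intro add_left_mono mult_left_mono) auto
  finally show ?thesis .
qed

definition log_reversed_OPUC :: "nat \<Rightarrow> complex \<Rightarrow> complex" where
  "log_reversed_OPUC n w = (\<Sum>j<n. Ln (1 - \<alpha> j * w * blaschke j w))"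

lemma one_minus_verblunsky_blaschke_notin_nonpos_Reals:
  assumes "norm w < 1"
  shows "1 - \<alpha> j * w * blaschke j w \<notin> \<real>\<^sub>\<le>\<^sub>0"
proof -
  have "norm (\<alpha> j * w * blaschke j w) \<le> norm (\<alpha> j) * norm w"
    using assms by (intro norm_verblunsky_blaschke_le) simp
  also have "\<dots> \<le> norm w"
    using norm_verblunsky_less_1[of j] by (simp add: mult_left_le_one_le)
  finally have "Re (1 - \<alpha> j * w * blaschke j w) > 0"
    using assms abs_Re_le_cmod[of "\<alpha> j * w * blaschke j w"] unfolding minus_complex.sel by simp
  then show ?thesis by (auto simp: complex_nonpos_Reals_iff)
qed

lemma exp_log_reversed_OPUC:
  assumes "norm w < 1"
  shows "exp (log_reversed_OPUC n w) = poly (rev\<Phi> n) w"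
proof -
  have "1 - \<alpha> j * w * blaschke j w \<noteq> 0" for j
    using one_minus_verblunsky_blaschke_notin_nonpos_Reals[OF assms, of j] by force
  then have "exp (log_reversed_OPUC n w) = (\<Prod>j<n. 1 - \<alpha> j * w * blaschke j w)"
    unfolding log_reversed_OPUC_def by (simp add: exp_sum)
  also have "\<dots> = poly (rev\<Phi> n) w"
    using assms by (intro reversed_OPUC_eq_prod [symmetric]) simp
  finally show ?thesis .
qed

lemma holomorphic_on_log_reversed_OPUC: "log_reversed_OPUC n holomorphic_on ball 0 1"
proof -
  have "blaschke j holomorphic_on ball 0 1" for j
    unfolding blaschke_def [abs_def] using reversed_OPUC_nonzero
    by (intro holomorphic_intros) auto
  then show ?thesis
    unfolding log_reversed_OPUC_def [abs_def]
    using one_minus_verblunsky_blaschke_notin_nonpos_Reals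
    by (intro holomorphic_intros) auto
qed

lemma norm_log_reversed_OPUC_le:
  assumes "norm w = 1 / 2"
  shows "norm (log_reversed_OPUC n w) \<le> (\<Sum>j<n. norm (\<alpha> j))"
proof -
  have "norm (Ln (1 - \<alpha> j * w * blaschke j w)) \<le> norm (\<alpha> j)" for j
  proof -
    have small: "norm (\<alpha> j * w * blaschke j w) \<le> norm (\<alpha> j) / 2"
      using norm_verblunsky_blaschke_le[of w j] assms by simp
    then have "norm (- (\<alpha> j * w * blaschke j w)) < 1 / 2"
      using norm_verblunsky_less_1[of j] by simp
    from norm_Ln_le[OF this] show ?thesis using small by simp
  qed
  then show ?thesis
    unfolding log_reversed_OPUC_def by (intro sum_norm_le)
qed

lemma norm_power_sum_zeros_le:
  "norm (\<Sum>z\<in>#proots (\<Phi> n). z ^ Suc k) \<le> Suc k * 2 ^ Suc k * (\<Sum>j<n. norm (\<alpha> j))"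
proof -
  let ?C = "image_mset cnj (proots (\<Phi> n))"
  have "norm (\<Sum>c\<in>#?C. c ^ Suc k) \<le> Suc k * (\<Sum>j<n. norm (\<alpha> j)) / (1 / 2) ^ Suc k"
  proof (rule norm_power_sum_le_of_log)
    show "exp (log_reversed_OPUC n w) = (\<Prod>c\<in>#?C. 1 - c * w)" if "w \<in> ball 0 1" for w
      using that
      by (simp add: exp_log_reversed_OPUC poly_reversed_poly_eq_prod image_mset.compositionality
          o_def)
  qed (use holomorphic_on_log_reversed_OPUC norm_log_reversed_OPUC_le in auto)
  moreover have "(\<Sum>c\<in>#image_mset cnj Z. c ^ Suc k) = cnj (\<Sum>z\<in>#Z. z ^ Suc k)" for Z
    by (induction Z) simp_all
  ultimately have "norm (\<Sum>z\<in>#proots (\<Phi> n). z ^ Suc k)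
      \<le> Suc k * (\<Sum>j<n. norm (\<alpha> j)) / (1 / 2) ^ Suc k"
    by (metis complex_mod_cnj)
  then show ?thesis by (simp add: power_one_over algebra_simps)
qed

lemma zero_counting_measure_eq:
  "zero_counting_measure mu n = measure_pmf (pmf_of_multiset (proots (\<Phi> n)))"
  by (simp add: zero_counting_measure_def zero_mset_def proots_def id_def)

lemma proots_OPUC_Suc_nonempty: "proots (\<Phi> (Suc n)) \<noteq> {#}"
  using size_proots_OPUC[of "Suc n"] size_eq_0_iff_empty by (metis nat.distinct(1))

abbreviation "\<nu> n \<equiv> zero_counting_measure mu (Suc n)"

lemma AE_zero_counting_measure:
  "(AE z in \<nu> n. P z) \<longleftrightarrow> (\<forall>z\<in>#proots (\<Phi> (Suc n)). P z)"
  unfolding zero_counting_measure_eq AE_measure_pmf_iff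
  by (simp only: set_pmf_of_multiset[OF proots_OPUC_Suc_nonempty])

lemma integrable_zero_counting_measure:
  fixes f :: "complex \<Rightarrow> 'a :: {banach, second_countable_topology}"
  shows "integrable (\<nu> n) f"
  unfolding zero_counting_measure_eq
  by (intro integrable_measure_pmf_finite)
    (simp only: set_pmf_of_multiset[OF proots_OPUC_Suc_nonempty] finite_set_mset)

lemma prob_space_zero_counting_measure: "prob_space (zero_counting_measure mu n)"
  unfolding zero_counting_measure_eq by (rule prob_space_measure_pmf)

lemma disk_prob_space_zero_counting_measure: "disk_prob_space (\<nu> n)"
proof (intro disk_prob_space.intro disk_prob_space_axioms.intro prob_space_zero_counting_measure)
  show "(\<lambda>z. z) \<in> borel_measurable (\<nu> n)"
    by (simp add: zero_counting_measure_eq)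
  show "AE z in \<nu> n. norm z \<le> 1"
    unfolding AE_zero_counting_measure by (blast intro: less_imp_le norm_proots_OPUC_less_1)
qed

lemma integral_zero_counting_measure:
  fixes f :: "complex \<Rightarrow> 'a :: {banach, second_countable_topology}"
  shows "(\<integral>z. f z \<partial>\<nu> n)
    = (\<Sum>z\<in>#proots (\<Phi> (Suc n)). f z) /\<^sub>R Suc n"
  unfolding zero_counting_measure_eq
  using integral_pmf_of_multiset[OF proots_OPUC_Suc_nonempty, of n f]
  by (simp only: size_proots_OPUC)

lemma integral_ln_zero_counting_measure:
  fixes f :: "complex \<Rightarrow> real"
  assumes "\<And>z. z \<in># proots (\<Phi> (Suc n)) \<Longrightarrow> f z \<noteq> 0"
  shows "(\<integral>z. ln (f z) \<partial>\<nu> n)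
    = ln (\<Prod>z\<in>#proots (\<Phi> (Suc n)). f z) / Suc n"
proof -
  have "ln (\<Prod>z\<in>#proots (\<Phi> (Suc n)). f z) = (\<Sum>z\<in>#proots (\<Phi> (Suc n)). ln (f z))"
    by (rule ln_prod_mset) (rule assms)
  then show ?thesis
    by (simp add: integral_zero_counting_measure divide_inverse_commute)
qed

end

section \<open>Asymptotic distribution of the zeros\<close>

lemma abs_diff_le_abs_ln_diff:
  fixes x y :: real
  assumes "0 < x" "x \<le> 1" "0 < y" "y \<le> 1"
  shows "\<bar>x - y\<bar> \<le> \<bar>ln x - ln y\<bar>"
proof -
  have "b - a \<le> ln b - ln a" if "0 < a" "a \<le> b" "b \<le> 1" for a b :: real
  proof -
    have "ln (a / b) \<le> a / b - 1" using that by (intro ln_le_minus_one) auto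
    then have "1 - a / b \<le> ln b - ln a" using that by (simp add: ln_div)
    moreover have "b - a \<le> 1 - a / b"
      using that mult_left_le[of b "b - a"] by (simp add: field_simps)
    ultimately show ?thesis by linarith
  qed
  from this[of x y] this[of y x] show ?thesis
    using assms by (cases "x \<le> y") auto
qed

lemma geometric_bound_of_root_tendsto:
  fixes a :: "nat \<Rightarrow> real"
  assumes "\<And>n. 0 \<le> a n" "(\<lambda>n. root n (a n)) \<longlonglongrightarrow> l" "l < R" "0 < R"
  obtains C where "0 < C" "\<And>n. a n \<le> C * R ^ n"
proof -
  have "eventually (\<lambda>n. root n (a n) < R) sequentially"
    using assms(2,3) by (rule order_tendstoD)
  then have "eventually (\<lambda>n. norm (a n / R ^ n) \<le> norm (1 :: real)) sequentially"
    using eventually_gt_at_top[of 0]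
  proof eventually_elim
    case (elim n)
    then have "a n \<le> R ^ n"
      using assms(1) power_mono[of "root n (a n)" R n] by simp
    then show ?case using assms(1,4) by simp
  qed
  then have "Bseq (\<lambda>n. a n / R ^ n)"
    by (rule Bseq_eventually_mono) simp
  then obtain C where "C > 0" "\<And>n. norm (a n / R ^ n) \<le> C"
    unfolding Bseq_def by blast
  then show thesis
    using assms(1,4) by (intro that[of C]) (simp_all add: divide_le_eq)
qed

lemma geometric_recurrence_bound:
  fixes x :: "nat \<Rightarrow> real"
  assumes "0 < R" "\<And>n. x (Suc n) \<le> R * x n + C * R ^ n"
  shows "x n \<le> (x 0 + C / R * n) * R ^ n"
proof (induction n)
  case (Suc n)
  have "x (Suc n) \<le> R * ((x 0 + C / R * n) * R ^ n) + C * R ^ n"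
    using assms(2)[of n] mult_left_mono[OF Suc, of R] assms(1) by linarith
  also have "\<dots> = (x 0 + C / R * Suc n) * R ^ Suc n"
    using assms(1) by (simp add: field_simps)
  finally show ?case .
qed simp

locale root_asymptotic_circle_measure = nontrivial_circle_measure +
  fixes r :: real
  assumes root_verblunsky: "(\<lambda>n. root n (norm (\<alpha> n))) \<longlonglongrightarrow> r"
    and cesaro_verblunsky: "(\<lambda>n. (\<Sum>j<n. norm (\<alpha> j)) / real n) \<longlonglongrightarrow> 0"
begin

lemma rate_nonneg: "0 \<le> r"
  by (rule LIMSEQ_le_const[OF root_verblunsky]) (auto intro!: real_root_ge_zero)

lemma rate_le_1: "r \<le> 1"
proof -
  have "root n (norm (\<alpha> n)) \<le> 1" for n
    using norm_verblunsky_less_1[of n] by (cases "n = 0") auto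
  then show ?thesis by (intro LIMSEQ_le_const2[OF root_verblunsky]) auto
qed

lemma root_verblunsky_exp_sum:
  "(\<lambda>n. root n (norm (\<alpha> n) * exp (\<Sum>j<n. norm (\<alpha> j)))) \<longlonglongrightarrow> r"
proof (rule Lim_transform_eventually)
  have "(\<lambda>n. root n (norm (\<alpha> n)) * exp ((\<Sum>j<n. norm (\<alpha> j)) / real n)) \<longlonglongrightarrow> r * exp 0"
    by (intro tendsto_intros root_verblunsky cesaro_verblunsky)
  then show "(\<lambda>n. root n (norm (\<alpha> n)) * exp ((\<Sum>j<n. norm (\<alpha> j)) / real n)) \<longlonglongrightarrow> r"
    by simp
  show "eventually (\<lambda>n. root n (norm (\<alpha> n)) * exp ((\<Sum>j<n. norm (\<alpha> j)) / real n)
      = root n (norm (\<alpha> n) * exp (\<Sum>j<n. norm (\<alpha> j)))) sequentially"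
    using eventually_gt_at_top[of 0]
  proof eventually_elim
    case (elim n)
    then have "exp (\<Sum>j<n. norm (\<alpha> j)) = exp ((\<Sum>j<n. norm (\<alpha> j)) / real n) ^ n"
      by (simp flip: exp_of_nat_mult)
    then show ?case
      using elim by (simp add: real_root_mult real_root_power_cancel)
  qed
qed

lemma norm_OPUC_geometric_bound:
  assumes "r < R" "\<rho> \<le> R" "\<rho> \<le> 1" "0 < R"
  obtains C where "0 < C"
    "\<And>n w. norm w \<le> \<rho> \<Longrightarrow> norm (poly (\<Phi> n) w) \<le> (1 + C * n) * R ^ n"
proof -
  define a where "a n = norm (\<alpha> n) * exp (\<Sum>j<n. norm (\<alpha> j))" for n
  have "(\<lambda>n. root n (a n)) \<longlonglongrightarrow> r"
    unfolding a_def by (rule root_verblunsky_exp_sum)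
  moreover have "0 \<le> a n" for n by (simp add: a_def)
  ultimately obtain C where C: "0 < C" "\<And>n. a n \<le> C * R ^ n"
    using geometric_bound_of_root_tendsto[of a r R] assms by blast
  show thesis
  proof (rule that[of "C / R"])
    fix n :: nat and w :: complex
    assume w: "norm w \<le> \<rho>"
    have "norm (poly (\<Phi> n) w) \<le> (norm (poly (\<Phi> 0) w) + C / R * n) * R ^ n"
    proof (rule geometric_recurrence_bound[OF assms(4)])
      fix n
      have "norm (poly (\<Phi> (Suc n)) w) \<le> norm w * norm (poly (\<Phi> n) w) + a n"
        unfolding a_def using w assms by (intro norm_OPUC_Suc_le) simp
      also have "\<dots> \<le> R * norm (poly (\<Phi> n) w) + C * R ^ n"
        using w assms C(2)[of n] by (intro add_mono mult_right_mono) auto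
      finally show "norm (poly (\<Phi> (Suc n)) w) \<le> R * norm (poly (\<Phi> n) w) + C * R ^ n" .
    qed
    then show "norm (poly (\<Phi> n) w) \<le> (1 + C / R * n) * R ^ n" by simp
  qed (use C(1) assms in simp)
qed

lemma mean_ln_max_norm_le:
  assumes "0 < \<rho>" "0 < B" "\<And>w. norm w = \<rho> \<Longrightarrow> norm (poly (\<Phi> (Suc n)) w) \<le> B"
  shows "(\<integral>z. ln (max (norm z) \<rho>) \<partial>\<nu> n) \<le> ln B / Suc n"
proof -
  let ?P = "\<Prod>z\<in>#proots (\<Phi> (Suc n)). max (norm z) \<rho>"
  have "?P > 0"
    using assms(1) by (intro prod_mset_pos) simp
  have mean: "(\<integral>z. ln (max (norm z) \<rho>) \<partial>\<nu> n) = ln ?P / Suc n"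
    using assms(1) by (intro integral_ln_zero_counting_measure) (auto simp: max_def)
  have "?P \<le> B"
    using assms by (intro prod_max_norm_le_sup_circle)
      (simp_all add: poly_eq_prod_proots[of "\<Phi> (Suc n)"])
  then have "ln ?P \<le> ln B"
    using \<open>?P > 0\<close> assms(2) by (intro ln_mono)
  then show ?thesis
    unfolding mean by (intro divide_right_mono) simp_all
qed

lemma mean_ln_max_norm_ge:
  assumes "0 < \<rho>"
  shows "ln \<rho> \<le> (\<integral>z. ln (max (norm z) \<rho>) \<partial>\<nu> n)"
proof -
  interpret nu: prob_space "\<nu> n" by (rule prob_space_zero_counting_measure)
  have "(\<integral>z. ln \<rho> \<partial>\<nu> n) \<le> (\<integral>z. ln (max (norm z) \<rho>) \<partial>\<nu> n)"
    using assms by (intro integral_mono integrable_zero_counting_measure) auto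
  then show ?thesis by (simp add: nu.prob_space)
qed

lemma tendsto_mean_ln_max_norm:
  assumes \<rho>: "0 < \<rho>" "\<rho> \<le> 1" "r \<le> \<rho>"
  shows "(\<lambda>n. \<integral>z. ln (max (norm z) \<rho>) \<partial>\<nu> n) \<longlonglongrightarrow> ln \<rho>"
proof (rule order_tendstoI)
  fix a assume "a < ln \<rho>"
  then have "a < (\<integral>z. ln (max (norm z) \<rho>) \<partial>\<nu> n)" for n
    using mean_ln_max_norm_ge[OF \<rho>(1)] by (rule less_le_trans)
  then show "eventually (\<lambda>n. a < (\<integral>z. ln (max (norm z) \<rho>) \<partial>\<nu> n)) sequentially"
    by simp
next
  fix a assume "ln \<rho> < a"
  define R where "R = exp ((ln \<rho> + a) / 2)"
  have "ln \<rho> < ln R" "ln R < a"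
    using \<open>ln \<rho> < a\<close> by (simp_all add: R_def field_simps)
  have "R > 0" by (simp add: R_def)
  then have "\<rho> < R" using \<open>ln \<rho> < ln R\<close> \<rho>(1) by simp
  then obtain C where C: "0 < C"
    "\<And>n w. norm w \<le> \<rho> \<Longrightarrow> norm (poly (\<Phi> n) w) \<le> (1 + C * n) * R ^ n"
    using norm_OPUC_geometric_bound[of R \<rho>] \<rho> \<open>R > 0\<close> by auto
  have bound: "(\<integral>z. ln (max (norm z) \<rho>) \<partial>\<nu> n) \<le> ln (1 + C * Suc n) / Suc n + ln R" for n
  proof -
    have pos: "1 + C * Suc n > 0"
      using C(1) by (intro add_pos_pos mult_pos_pos) auto
    have "(\<integral>z. ln (max (norm z) \<rho>) \<partial>\<nu> n) \<le> ln ((1 + C * Suc n) * R ^ Suc n) / Suc n"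
      using \<rho>(1) pos \<open>R > 0\<close>
      by (intro mean_ln_max_norm_le mult_pos_pos zero_less_power C(2)) simp_all
    also have "ln ((1 + C * Suc n) * R ^ Suc n) = ln (1 + C * Suc n) + Suc n * ln R"
      using pos \<open>R > 0\<close> by (simp add: ln_mult ln_realpow del: power_Suc of_nat_Suc)
    finally show ?thesis by (simp add: add_divide_distrib)
  qed
  have "(\<lambda>n. ln (1 + C * Suc n) / Suc n + ln R) \<longlonglongrightarrow> ln R"
    using C(1) by real_asymp
  then have "eventually (\<lambda>n. ln (1 + C * Suc n) / Suc n + ln R < a) sequentially"
    using \<open>ln R < a\<close> by (rule order_tendstoD)
  then show "eventually (\<lambda>n. (\<integral>z. ln (max (norm z) \<rho>) \<partial>\<nu> n) < a) sequentially"
    by eventually_elim (rule le_less_trans[OF bound])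
qed

lemma eventually_verblunsky_nonzero:
  assumes "r > 0"
  shows "eventually (\<lambda>n. \<alpha> n \<noteq> 0) sequentially"
proof -
  have "eventually (\<lambda>n. root n (norm (\<alpha> n)) > 0) sequentially"
    using root_verblunsky assms by (rule order_tendstoD)
  then show ?thesis
    using eventually_gt_at_top[of 0] by eventually_elim auto
qed

lemma proots_OPUC_Suc_nonzero:
  assumes "\<alpha> n \<noteq> 0" "z \<in># proots (\<Phi> (Suc n))"
  shows "z \<noteq> 0"
  using assms by (auto simp: verblunsky_def)

lemma tendsto_mean_ln_norm:
  assumes "r > 0"
  shows "(\<lambda>n. \<integral>z. ln (norm z) \<partial>\<nu> n) \<longlonglongrightarrow> ln r"
proof (rule Lim_transform_eventually)
  have "(\<lambda>n. ln (root n (norm (\<alpha> n))) * (real n / real (Suc n))) \<longlonglongrightarrow> ln r * 1"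
    using assms by (intro tendsto_intros root_verblunsky LIMSEQ_n_over_Suc_n) auto
  then show "(\<lambda>n. ln (root n (norm (\<alpha> n))) * (real n / real (Suc n))) \<longlonglongrightarrow> ln r"
    by simp
  show "eventually (\<lambda>n. ln (root n (norm (\<alpha> n))) * (real n / real (Suc n))
      = (\<integral>z. ln (norm z) \<partial>\<nu> n)) sequentially"
    using eventually_verblunsky_nonzero[OF assms] eventually_gt_at_top[of 0]
  proof eventually_elim
    case (elim n)
    have "norm z \<noteq> 0" if "z \<in># proots (\<Phi> (Suc n))" for z
      using proots_OPUC_Suc_nonzero[OF elim(1) that] by simp
    then have "(\<integral>z. ln (norm z) \<partial>\<nu> n) = ln (norm (\<alpha> n)) / Suc n"
      unfolding norm_verblunsky_eq_prod_zeros by (rule integral_ln_zero_counting_measure)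
    then show ?case using elim by (simp add: ln_root)
  qed
qed

lemma mean_radius_deviation_le:
  assumes "\<alpha> n \<noteq> 0" "0 < r"
  shows "(\<integral>z. \<bar>norm z - r\<bar> \<partial>\<nu> n)
    \<le> 2 * (\<integral>z. ln (max (norm z) r) \<partial>\<nu> n) - (\<integral>z. ln (norm z) \<partial>\<nu> n) - ln r"
proof -
  interpret nu: prob_space "\<nu> n" by (rule prob_space_zero_counting_measure)
  have "\<bar>norm z - r\<bar> \<le> 2 * ln (max (norm z) r) - ln (norm z) - ln r"
    if "z \<in># proots (\<Phi> (Suc n))" for z
  proof -
    have "0 < norm z" "norm z \<le> 1"
      using proots_OPUC_Suc_nonzero[OF assms(1) that] norm_proots_OPUC_less_1[OF that] by auto
    then have "\<bar>norm z - r\<bar> \<le> \<bar>ln (norm z) - ln r\<bar>"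
      using assms(2) rate_le_1 by (intro abs_diff_le_abs_ln_diff)
    also have "\<dots> = 2 * ln (max (norm z) r) - ln (norm z) - ln r"
      using \<open>0 < norm z\<close> assms(2) by (auto simp: max_def)
    finally show ?thesis .
  qed
  then have "(\<integral>z. \<bar>norm z - r\<bar> \<partial>\<nu> n) \<le> (\<integral>z. 2 * ln (max (norm z) r) - ln (norm z) - ln r \<partial>\<nu> n)"
    by (intro integral_mono_AE integrable_zero_counting_measure)
       (simp add: AE_zero_counting_measure)
  also have "\<dots> = 2 * (\<integral>z. ln (max (norm z) r) \<partial>\<nu> n) - (\<integral>z. ln (norm z) \<partial>\<nu> n) - ln r"
    by (simp add: integrable_zero_counting_measure nu.prob_space)
  finally show ?thesis .
qed

lemma mean_norm_le:
  assumes "0 < \<rho>" "\<rho> \<le> 1"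
  shows "(\<integral>z. norm z \<partial>\<nu> n) \<le> \<rho> + ((\<integral>z. ln (max (norm z) \<rho>) \<partial>\<nu> n) - ln \<rho>)"
proof -
  interpret nu: prob_space "\<nu> n" by (rule prob_space_zero_counting_measure)
  have "norm z \<le> \<rho> + (ln (max (norm z) \<rho>) - ln \<rho>)" if "z \<in># proots (\<Phi> (Suc n))" for z
  proof (cases "norm z \<le> \<rho>")
    case False
    then have "0 < norm z" using assms(1) by linarith
    then have "\<bar>norm z - \<rho>\<bar> \<le> \<bar>ln (norm z) - ln \<rho>\<bar>"
      using norm_proots_OPUC_less_1[OF that] assms by (intro abs_diff_le_abs_ln_diff) auto
    then show ?thesis using False \<open>0 < norm z\<close> assms(1) by (simp add: max_def)
  qed (simp add: max_def)
  then have "(\<integral>z. norm z \<partial>\<nu> n) \<le> (\<integral>z. \<rho> + (ln (max (norm z) \<rho>) - ln \<rho>) \<partial>\<nu> n)"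
    by (intro integral_mono_AE integrable_zero_counting_measure)
       (simp add: AE_zero_counting_measure)
  then show ?thesis
    by (simp add: integrable_zero_counting_measure nu.prob_space)
qed

lemma tendsto_mean_radius_deviation_pos:
  assumes "r > 0"
  shows "(\<lambda>n. \<integral>z. \<bar>norm z - r\<bar> \<partial>\<nu> n) \<longlonglongrightarrow> 0"
proof (rule tendsto_sandwich[OF _ _ tendsto_const])
  show "eventually (\<lambda>n. (\<integral>z. \<bar>norm z - r\<bar> \<partial>\<nu> n)
      \<le> 2 * (\<integral>z. ln (max (norm z) r) \<partial>\<nu> n) - (\<integral>z. ln (norm z) \<partial>\<nu> n) - ln r) sequentially"
    using eventually_verblunsky_nonzero[OF assms]
    by eventually_elim (rule mean_radius_deviation_le[OF _ assms])
  have "(\<lambda>n. 2 * (\<integral>z. ln (max (norm z) r) \<partial>\<nu> n) - (\<integral>z. ln (norm z) \<partial>\<nu> n) - ln r)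
      \<longlonglongrightarrow> 2 * ln r - ln r - ln r"
    using assms rate_le_1
    by (intro tendsto_intros tendsto_mean_ln_max_norm tendsto_mean_ln_norm) auto
  then show "(\<lambda>n. 2 * (\<integral>z. ln (max (norm z) r) \<partial>\<nu> n) - (\<integral>z. ln (norm z) \<partial>\<nu> n) - ln r)
      \<longlonglongrightarrow> 0" by simp
qed simp

lemma tendsto_mean_norm_0:
  assumes "r = 0"
  shows "(\<lambda>n. \<integral>z. norm z \<partial>\<nu> n) \<longlonglongrightarrow> 0"
proof (rule order_tendstoI)
  fix e :: real assume "0 < e"
  define \<rho> where "\<rho> = min 1 (e / 2)"
  have \<rho>: "0 < \<rho>" "\<rho> \<le> 1" "\<rho> \<le> e / 2" using \<open>0 < e\<close> by (auto simp: \<rho>_def)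
  have "eventually (\<lambda>n. (\<integral>z. ln (max (norm z) \<rho>) \<partial>\<nu> n) < ln \<rho> + e / 2) sequentially"
    using \<rho> assms \<open>0 < e\<close> by (intro order_tendstoD(2)[OF tendsto_mean_ln_max_norm]) auto
  then show "eventually (\<lambda>n. (\<integral>z. norm z \<partial>\<nu> n) < e) sequentially"
  proof eventually_elim
    case (elim n)
    then show ?case using mean_norm_le[OF \<rho>(1,2), of n] \<rho>(3) by simp
  qed
next
  fix e :: real assume "e < 0"
  then have "e < (\<integral>z. norm z \<partial>\<nu> n)" for n
    by (rule less_le_trans) simp
  then show "eventually (\<lambda>n. e < (\<integral>z. norm z \<partial>\<nu> n)) sequentially"
    by simp
qed

lemma tendsto_mean_radius_deviation: "(\<lambda>n. \<integral>z. \<bar>norm z - r\<bar> \<partial>\<nu> n) \<longlonglongrightarrow> 0"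
  using tendsto_mean_radius_deviation_pos tendsto_mean_norm_0 rate_nonneg
  by (cases "r = 0") simp_all

lemma tendsto_moment_zero_counting_measure:
  "(\<lambda>n. \<integral>z. z ^ Suc k \<partial>\<nu> n) \<longlonglongrightarrow> 0"
proof (rule Lim_null_comparison)
  let ?c = "Suc k * 2 ^ Suc k :: real"
  show "eventually (\<lambda>n. norm (\<integral>z. z ^ Suc k \<partial>\<nu> n)
      \<le> ?c * ((\<Sum>j<Suc n. norm (\<alpha> j)) / Suc n)) sequentially"
  proof (intro always_eventually allI)
    fix n
    have "norm (\<integral>z. z ^ Suc k \<partial>\<nu> n) = norm (\<Sum>z\<in>#proots (\<Phi> (Suc n)). z ^ Suc k) / Suc n"
      by (subst integral_zero_counting_measure) (simp_all add: divide_inverse_commute)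
    also have "\<dots> \<le> ?c * (\<Sum>j<Suc n. norm (\<alpha> j)) / Suc n"
      by (intro divide_right_mono norm_power_sum_zeros_le) simp
    also have "\<dots> = ?c * ((\<Sum>j<Suc n. norm (\<alpha> j)) / Suc n)"
      by simp
    finally show "norm (\<integral>z. z ^ Suc k \<partial>\<nu> n) \<le> ?c * ((\<Sum>j<Suc n. norm (\<alpha> j)) / Suc n)" .
  qed
  show "(\<lambda>n. ?c * ((\<Sum>j<Suc n. norm (\<alpha> j)) / Suc n)) \<longlonglongrightarrow> 0"
    by (rule tendsto_mult_right_zero[OF LIMSEQ_Suc[OF cesaro_verblunsky]])
qed

lemma tendsto_moment_circle_uniform:
  "(\<lambda>n. \<integral>z. z ^ k \<partial>\<nu> n) \<longlonglongrightarrow> (\<integral>z. z ^ k \<partial>circle_uniform r)"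
proof (cases k)
  case 0
  have "prob_space (circle_uniform r)"
    using disk_prob_space_circle_uniform rate_nonneg rate_le_1 by (simp add: disk_prob_space_def)
  then show ?thesis
    using 0 prob_space_zero_counting_measure by (simp add: prob_space.prob_space)
next
  case (Suc j)
  then show ?thesis
    using tendsto_moment_zero_counting_measure[of j] moment_circle_uniform[of "Suc j" r] by simp
qed

lemma tendsto_integral_zero_counting_measure:
  fixes f :: "complex \<Rightarrow> real"
  assumes "continuous_on UNIV f"
  shows "(\<lambda>n. \<integral>z. f z \<partial>\<nu> n) \<longlonglongrightarrow> (\<integral>z. f z \<partial>circle_uniform r)"
proof -
  have circle: "disk_prob_space (circle_uniform r)" "AE z in circle_uniform r. norm z = r"
    using disk_prob_space_circle_uniform[of r] AE_circle_uniform[of r] rate_nonneg rate_le_1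
    by simp_all
  note zeros = disk_prob_space_zero_counting_measure
  show ?thesis
    by (rule tendsto_integral_of_mixed_moments[OF zeros circle(1) _ assms])
       (rule tendsto_mixed_moment[OF zeros circle(1) rate_nonneg rate_le_1 circle(2)
          tendsto_mean_radius_deviation tendsto_moment_circle_uniform])
qed

end

theorem theorem6p2:
  fixes mu :: "complex measure" and r :: real
  assumes "prob_space mu"
    and "sets mu = sets borel"
    and "emeasure mu (- sphere 0 1) = 0"
    and "infinite (msupport mu)"
    and "(\<lambda>n. root n (cmod (verblunsky mu n))) \<longlonglongrightarrow> r"
    and "(\<lambda>n. (\<Sum>j<n. cmod (verblunsky mu j)) / real n) \<longlonglongrightarrow> 0"
  shows "weak_conv_c (zero_counting_measure mu) (circle_uniform r)"
proof -
  interpret root_asymptotic_circle_measure mu r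
    using assms
    by (intro root_asymptotic_circle_measure.intro root_asymptotic_circle_measure_axioms.intro
        nontrivial_circle_measure.intro nontrivial_circle_measure_axioms.intro)
  show ?thesis
    unfolding weak_conv_c_def
    using LIMSEQ_imp_Suc[OF tendsto_integral_zero_counting_measure] by simp
qed

end
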